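(* Let $\Lambda \subseteq \mathbb{R}^n$ be a lattice and let $\Vert \cdot \Vert$ be any norm on $\mathbb{R}^n$. Then the Voronoi cell $\mathcal{V}(\Lambda, \Vert \cdot \Vert)$ is equal to $$\tilde{\mathcal{V}}^{(g)}(\Lambda, \Vert \cdot \Vert) := \{ x \in \mathbb{R}^n \mid \Vert x \Vert \leq \Vert x-v \Vert \text{ for all } v \in \Lambda \text{ that are weak Voronoi-relevant with respect to } \Vert \cdot \Vert \}.$$
   Context: A lattice $\Lambda \subseteq \mathbb{R}^n$ is a discrete additive subgroup of $\mathbb{R}^n$; all lattices are assumed to have full rank $n$, i.e. $\Lambda$ spans $\mathbb{R}^n$ over $\mathbb{R}$. The Voronoi cell is $\mathcal{V}(\Lambda, \Vert \cdot \Vert) := \{ x \in \mathbb{R}^n \mid \forall v \in \Lambda: \Vert x \Vert \leq \Vert x-v \Vert \}$. A vector $v \in \Lambda \setminus \{0\}$ is weak Voronoi-relevant (with respect to $\Vert\cdot\Vert$) if there is some $x \in \mathbb{R}^n$ such that $\Vert x \Vert = \Vert x-v \Vert \leq \Vert x-w \Vert$ for all $w \in \Lambda$. *)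

theory Defs
  imports "HOL-Analysis.Analysis"
begin

text \<open>
  The library constant \<^const>\<open>norm\<close> on \<^typ>\<open>real ^ 'n\<close> is the Euclidean norm. An arbitrary norm is
  therefore a function argument satisfying the predicate below.
\<close>

definition is_norm :: "(real ^ 'n \<Rightarrow> real) \<Rightarrow> bool" where
  "is_norm N \<longleftrightarrow>
     (\<forall>x. 0 \<le> N x) \<and>
     (\<forall>x. N x = 0 \<longleftrightarrow> x = 0) \<and>
     (\<forall>a x. N (a *\<^sub>R x) = \<bar>a\<bar> * N x) \<and>
     (\<forall>x y. N (x + y) \<le> N x + N y)"

text \<open>Discreteness refers to the standard topology of \<^typ>\<open>real ^ 'n\<close>.\<close>

definition full_rank_lattice :: "(real ^ 'n) set \<Rightarrow> bool" where
  "full_rank_lattice L \<longleftrightarrow>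
     0 \<in> L \<and> (\<forall>x\<in>L. \<forall>y\<in>L. x + y \<in> L) \<and> (\<forall>x\<in>L. - x \<in> L) \<and>
     discrete L \<and> span L = UNIV"

definition voronoi_cell :: "(real ^ 'n) set \<Rightarrow> (real ^ 'n \<Rightarrow> real) \<Rightarrow> (real ^ 'n) set" where
  "voronoi_cell L N = {x. \<forall>v\<in>L. N x \<le> N (x - v)}"

definition weak_voronoi_relevant ::
    "(real ^ 'n) set \<Rightarrow> (real ^ 'n \<Rightarrow> real) \<Rightarrow> real ^ 'n \<Rightarrow> bool" where
  "weak_voronoi_relevant L N v \<longleftrightarrow>
     v \<in> L - {0} \<and> (\<exists>x. N x = N (x - v) \<and> (\<forall>w\<in>L. N (x - v) \<le> N (x - w)))"

definition weak_voronoi_cell :: "(real ^ 'n) set \<Rightarrow> (real ^ 'n \<Rightarrow> real) \<Rightarrow> (real ^ 'n) set" where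
  "weak_voronoi_cell L N = {x. \<forall>v\<in>L. weak_voronoi_relevant L N v \<longrightarrow> N x \<le> N (x - v)}"

end

theory Submission
  imports Defs
begin

text \<open>
  If \<open>x\<close> is outside the Voronoi cell, only finitely many lattice vectors \<open>v\<close> are closer to \<open>x\<close>
  than \<open>0\<close> is. Moving from \<open>0\<close> towards \<open>x\<close>, stop at the first point \<open>t x\<close> at which some such \<open>v\<close>
  is at least as close as \<open>0\<close>. By the triangle inequality, a lattice vector that beats \<open>0\<close> strictly
  at \<open>t x\<close> still does so at \<open>x\<close>, and already ties with \<open>0\<close> slightly before \<open>t x\<close>; so there is
  none. Hence \<open>t x\<close> witnesses that \<open>v\<close> is weak Voronoi-relevant, while \<open>v\<close> separates \<open>x\<close> from
  the cell.
\<close>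

context
  fixes N :: "real ^ 'n \<Rightarrow> real"
  assumes N: "is_norm N"
begin

lemma is_norm_nonneg: "0 \<le> N x"
  and is_norm_eq_0_iff: "N x = 0 \<longleftrightarrow> x = 0"
  and is_norm_scaleR: "N (a *\<^sub>R x) = \<bar>a\<bar> * N x"
  and is_norm_triangle: "N (x + y) \<le> N x + N y"
  using N unfolding is_norm_def by auto

text \<open>Homogeneity and the triangle inequality make \<open>N\<close> convex, and convex
  functions on finite-dimensional spaces are continuous.\<close>

lemma continuous_on_is_norm: "continuous_on UNIV N"
proof (rule convex_on_continuous)
  show "convex_on UNIV N"
  proof (rule convex_onI)
    fix t :: real and x y
    assume "0 < t" "t < 1"
    then show "N ((1 - t) *\<^sub>R x + t *\<^sub>R y) \<le> (1 - t) * N x + t * N y"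
      using is_norm_triangle[of "(1 - t) *\<^sub>R x" "t *\<^sub>R y"] by (simp add: is_norm_scaleR)
  qed auto
qed auto

text \<open>The constant is the minimum of \<open>N\<close> on the compact Euclidean unit sphere;
  homogeneity extends the bound to all vectors.\<close>

lemma is_norm_bounds_norm:
  obtains c where "c > 0" "\<And>x. c * norm x \<le> N x"
proof -
  obtain z :: "real ^ 'n" where z: "norm z = 1" and min: "\<And>u. norm u = 1 \<Longrightarrow> N z \<le> N u"
    using continuous_attains_inf[of "sphere 0 1" N] continuous_on_subset[OF continuous_on_is_norm]
    by auto
  show thesis
  proof
    show "N z > 0"
      using z is_norm_nonneg[of z] is_norm_eq_0_iff[of z] by force
    fix x :: "real ^ 'n"
    show "N z * norm x \<le> N x"
    proof (cases "x = 0")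
      case False
      then have "N z \<le> N (inverse (norm x) *\<^sub>R x)"
        by (intro min) simp
      then show ?thesis
        using False by (simp add: is_norm_scaleR field_simps)
    qed (simp add: is_norm_nonneg)
  qed
qed

text \<open>Differences of lattice vectors are lattice vectors, so the gap around 0 separates all of
  \<open>L\<close> uniformly. A bounded uniformly discrete set is finite.\<close>

lemma finite_lattice_ball:
  assumes "full_rank_lattice L"
  shows "finite {v \<in> L. N (x - v) < r}"
proof -
  have L: "0 \<in> L" "\<And>u v. u \<in> L \<Longrightarrow> v \<in> L \<Longrightarrow> u - v \<in> L" "discrete L"
    using assms unfolding full_rank_lattice_def
    by (auto simp: diff_conv_add_uminus simp del: add_uminus_conv_diff)
  obtain d where d: "d > 0" "\<And>y. y \<in> L \<Longrightarrow> dist 0 y < d \<Longrightarrow> y = 0"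
    using isolated_inE_dist[OF discreteD[OF L(3,1)]] by blast
  have "uniform_discrete L"
  proof (rule uniformI1[OF d(1)])
    fix u v assume "u \<in> L" "v \<in> L" "dist u v < d"
    then show "u = v"
      using d(2)[of "u - v"] L(2)[of u v] by (simp add: dist_norm norm_minus_commute)
  qed
  then have "uniform_discrete {v \<in> L. N (x - v) < r}"
    by (rule uniform_discrete_subset) auto
  moreover
  obtain c where c: "c > 0" "\<And>x. c * norm x \<le> N x"
    using is_norm_bounds_norm by blast
  have "bounded {v \<in> L. N (x - v) < r}"
  proof (rule bounded_subset[OF bounded_cball])
    show "{v \<in> L. N (x - v) < r} \<subseteq> cball x (r / c)"
    proof safe
      fix v assume "N (x - v) < r"
      then show "v \<in> cball x (r / c)"
        using c(1) c(2)[of "x - v"] by (simp add: dist_norm field_simps)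
    qed
  qed
  ultimately show ?thesis
    using uniform_discrete_finite_iff by blast
qed

lemma is_norm_diff_along_segment:
  "N (s *\<^sub>R x - v) \<le> N (t *\<^sub>R x - v) + \<bar>s - t\<bar> * N x"
proof -
  have "s *\<^sub>R x - v = (t *\<^sub>R x - v) + (s - t) *\<^sub>R x"
    by (simp add: algebra_simps)
  then show ?thesis
    using is_norm_triangle[of "t *\<^sub>R x - v" "(s - t) *\<^sub>R x"] by (simp only: is_norm_scaleR)
qed

lemma weak_voronoi_relevant_separates:
  assumes L: "full_rank_lattice L" and "x \<notin> voronoi_cell L N"
  obtains v where "weak_voronoi_relevant L N v" "N (x - v) < N x"
proof -
  define F where "F = {v \<in> L. N (x - v) < N x}"
  \<comment> \<open>Since \<open>s\<close> is nonnegative, \<open>s * N x\<close> is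
    \<open>N (s *\<^sub>R x)\<close>.\<close>
  define K where "K = (\<Union>v\<in>F. {s \<in> {0..1}. N (s *\<^sub>R x - v) \<le> s * N x})"
  have "F \<noteq> {}"
    using assms(2) unfolding voronoi_cell_def F_def by (auto simp: not_le)
  then have "K \<noteq> {}"
    unfolding K_def F_def by (force intro: exI[of _ 1])
  have "compact {s \<in> {0..1}. N (s *\<^sub>R x - v) \<le> s * N x}" for v
    unfolding Collect_conj_eq Collect_mem_eq
    by (intro compact_Int_closed compact_Icc closed_Collect_le continuous_intros
        continuous_on_compose2[OF continuous_on_is_norm]) auto
  \<comment> \<open>Finiteness of \<open>F\<close> enters here: the first parameter \<open>t\<close>
    exists because the union is finite.\<close>
  then have "compact K"
    unfolding K_def F_def by (intro compact_UN finite_lattice_ball L) auto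
  then obtain t where "t \<in> K" and t_min: "\<And>s. s \<in> K \<Longrightarrow> t \<le> s"
    using compact_attains_inf \<open>K \<noteq> {}\<close> by metis
  then obtain v where v: "v \<in> L" "N (x - v) < N x" "N (t *\<^sub>R x - v) \<le> t * N x"
    and t: "0 \<le> t" "t \<le> 1"
    unfolding K_def F_def by auto
  have Nx: "N x > 0"
    using v(2) is_norm_nonneg[of "x - v"] by linarith
  have no_closer: "t * N x \<le> N (t *\<^sub>R x - w)" if "w \<in> L" for w
  proof (rule ccontr)
    assume "\<not> t * N x \<le> N (t *\<^sub>R x - w)"
    then have w: "N (t *\<^sub>R x - w) < t * N x" by simp
    have "N (x - w) \<le> N (t *\<^sub>R x - w) + (1 - t) * N x"
      using is_norm_diff_along_segment[of 1 x w t] t by simp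
    then have "w \<in> F"
      using w that unfolding F_def by (simp add: algebra_simps)
    \<comment> \<open>Stepping back by \<open>e\<close> costs each side of the inequality at most
      \<open>e * N x\<close>, so half the gap, divided by \<open>N x\<close>, is the largest step
      guaranteed to keep \<open>w\<close> at least as close as 0.\<close>
    define e where "e = (t * N x - N (t *\<^sub>R x - w)) / (2 * N x)"
    have e: "e > 0" "2 * (e * N x) = t * N x - N (t *\<^sub>R x - w)"
      using w Nx unfolding e_def by simp_all
    \<comment> \<open>The gap is at most \<open>t * N x\<close>, so \<open>t - e\<close> stays in
      the unit interval.\<close>
    have "e * N x \<le> t * N x"
      using e is_norm_nonneg[of "t *\<^sub>R x - w"] w by linarith
    then have "e \<le> t"
      using Nx by simp
    moreover have "N ((t - e) *\<^sub>R x - w) \<le> (t - e) * N x"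
      using is_norm_diff_along_segment[of "t - e" x w t] e by (simp add: algebra_simps)
    ultimately have "t - e \<in> K"
      using \<open>w \<in> F\<close> e(1) t unfolding K_def by auto
    then show False
      using t_min e(1) by force
  qed
  have eq: "N (t *\<^sub>R x - v) = t * N x"
    using v(3) no_closer[OF v(1)] by simp
  have "weak_voronoi_relevant L N v"
    unfolding weak_voronoi_relevant_def
  proof (intro conjI exI ballI)
    show "v \<in> L - {0}"
      \<comment> \<open>For \<open>v = 0\<close> the strict inequality would read
        \<open>N x < N x\<close>.\<close>
      using v by auto
    show "N (t *\<^sub>R x) = N (t *\<^sub>R x - v)"
      using eq t by (simp add: is_norm_scaleR)
    show "N (t *\<^sub>R x - v) \<le> N (t *\<^sub>R x - w)" if "w \<in> L" for w
      using no_closer[OF that] eq by simp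
  qed
  then show thesis
    using v(2) that by blast
qed

end

theorem theorem3:
  fixes L :: "(real ^ 'n) set" and N :: "real ^ 'n \<Rightarrow> real"
  assumes "full_rank_lattice L" and "is_norm N"
  shows "voronoi_cell L N = weak_voronoi_cell L N"
proof
  show "voronoi_cell L N \<subseteq> weak_voronoi_cell L N"
    unfolding voronoi_cell_def weak_voronoi_cell_def by auto
  show "weak_voronoi_cell L N \<subseteq> voronoi_cell L N"
  proof (rule subsetI, rule ccontr)
    fix x assume x: "x \<in> weak_voronoi_cell L N" and "x \<notin> voronoi_cell L N"
    then obtain v where "weak_voronoi_relevant L N v" "N (x - v) < N x"
      using weak_voronoi_relevant_separates[OF assms(2,1)] by blast
    then show False
      using x unfolding weak_voronoi_cell_def weak_voronoi_relevant_def by force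
  qed
qed

end
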